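(* Let $q$ be a prime power, $d\ge 0$ and $m\ge 1$ integers, $a_0,a_1,\dots,a_m$ positive integers, and $a=\min\{\operatorname{lcm}(a_r,a_s): 0\le r<s\le m\}$. Assume that $a\mid d$. Then $$e_q(d;a_0,a_1,\dots,a_m)\ \ge\ \min\left\{p_m,\ \frac{d}{a}q^{m-1}+p_{m-2}\right\}.$$
   Context: For an integer $r\ge 0$ put $p_r=q^r+q^{r-1}+\dots+1$, and $p_r=0$ for $r<0$. For positive integers $a_0,\dots,a_m$ the weighted projective space is $\mathbb{P}(a_0,\dots,a_m)=(\overline{\mathbb{F}}_q^{\,m+1}\setminus\{0\})/\sim$, where $(x_0,\dots,x_m)\sim(\lambda^{a_0}x_0,\dots,\lambda^{a_m}x_m)$ for all $\lambda\in\overline{\mathbb{F}}_q^{\,*}$. The class of $(x_0,\dots,x_m)$ is written $(x_0:\dots:x_m)$. It is $\mathbb{F}_q$-rational if $(x_0:\dots:x_m)=(x_0^q:\dots:x_m^q)$; every $\mathbb{F}_q$-rational point has exactly $q-1$ representatives in $\mathbb{F}_q^{m+1}\setminus\{0\}$. A polynomial $F\in\mathbb{F}_q[X_0,\dots,X_m]$ is weighted homogeneous of degree $d$ if it is homogeneous of degree $d$ for the grading in which $X_i$ has degree $a_i$, and $V(F)$ denotes the set of $\mathbb{F}_q$-rational points of $\mathbb{P}(a_0,\dots,a_m)$ at which $F$ vanishes. Finally, $e_q(d;a_0,\dots,a_m)$ is the maximum of $|V(F)|$ over all nonzero weighted homogeneous polynomials $F\in\mathbb{F}_q[X_0,\dots,X_m]$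 of degree $d$ (defined when such polynomials exist).
   Formalization: The case d = 0 with m ≥ 2 is excluded: there the only nonzero weighted homogeneous polynomials are nonzero constants, so e_q = 0, while the claimed bound is p_{m-2} ≥ 1 and the inequality fails. *)

theory Defs
  imports
    "HOL-Algebra.Algebraic_Closure_Type"
    "HOL-Library.Cardinality"
    "HOL-Library.Poly_Mapping"
begin

text \<open>
  The field with \<open>q\<close> elements is a type \<open>'k :: {field, finite}\<close> with \<open>q = CARD('k)\<close>, and
  \<open>'k alg_closure\<close> is its algebraic closure.  A point \<open>(x\<^sub>0, \<dots>, x\<^sub>m)\<close> of affine
  \<open>(m + 1)\<close>-space is a function on \<open>nat\<close> that vanishes above \<open>m\<close>; only the values of the
  weight function \<open>a\<close> on \<open>{..m}\<close> matter.
\<close>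

definition p_num :: "nat \<Rightarrow> int \<Rightarrow> nat" where
  "p_num q r = (if r < 0 then 0 else \<Sum>i\<le>nat r. q ^ i)"

definition nonzero_vectors :: "nat \<Rightarrow> (nat \<Rightarrow> 'k::field alg_closure) set" where
  "nonzero_vectors m = {x. (\<forall>i>m. x i = 0) \<and> (\<exists>i\<le>m. x i \<noteq> 0)}"

definition wproj_rel ::
    "nat \<Rightarrow> (nat \<Rightarrow> nat) \<Rightarrow> (nat \<Rightarrow> 'k::field alg_closure) rel" where
  "wproj_rel m a = {(x, y). x \<in> nonzero_vectors m \<and> y \<in> nonzero_vectors m \<and>
     (\<exists>l. l \<noteq> 0 \<and> (\<forall>i\<le>m. y i = l ^ a i * x i))}"

definition wproj_space ::
    "nat \<Rightarrow> (nat \<Rightarrow> nat) \<Rightarrow> (nat \<Rightarrow> 'k::field alg_closure) set set" where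
  "wproj_space m a = nonzero_vectors m // wproj_rel m a"

definition wproj_point ::
    "nat \<Rightarrow> (nat \<Rightarrow> nat) \<Rightarrow> (nat \<Rightarrow> 'k::field alg_closure) \<Rightarrow> (nat \<Rightarrow> 'k alg_closure) set" where
  "wproj_point m a x = wproj_rel m a `` {x}"

definition rational_points ::
    "nat \<Rightarrow> (nat \<Rightarrow> nat) \<Rightarrow> (nat \<Rightarrow> 'k::{field, finite} alg_closure) set set" where
  "rational_points m a =
     {P \<in> wproj_space m a. \<forall>x\<in>P. wproj_point m a x = wproj_point m a (\<lambda>i. x i ^ CARD('k))}"

text \<open>
  Multivariate polynomials over \<open>'k\<close> are finitely supported maps from exponent vectors
  (themselves finitely supported) to coefficients.
\<close>

type_synonym 'k mpolynomial = "(nat \<Rightarrow>\<^sub>0 nat) \<Rightarrow>\<^sub>0 'k"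

definition in_variables :: "nat \<Rightarrow> 'k::zero mpolynomial \<Rightarrow> bool" where
  "in_variables m F \<longleftrightarrow> (\<forall>\<alpha>\<in>Poly_Mapping.keys F. Poly_Mapping.keys \<alpha> \<subseteq> {..m})"

definition weighted_degree :: "(nat \<Rightarrow> nat) \<Rightarrow> (nat \<Rightarrow>\<^sub>0 nat) \<Rightarrow> nat" where
  "weighted_degree a \<alpha> = (\<Sum>i\<in>Poly_Mapping.keys \<alpha>. a i * Poly_Mapping.lookup \<alpha> i)"

definition weighted_homogeneous :: "(nat \<Rightarrow> nat) \<Rightarrow> nat \<Rightarrow> 'k::zero mpolynomial \<Rightarrow> bool" where
  "weighted_homogeneous a d F \<longleftrightarrow> (\<forall>\<alpha>\<in>Poly_Mapping.keys F. weighted_degree a \<alpha> = d)"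

definition eval_mpolynomial ::
    "'k::field mpolynomial \<Rightarrow> (nat \<Rightarrow> 'k alg_closure) \<Rightarrow> 'k alg_closure" where
  "eval_mpolynomial F x =
     (\<Sum>\<alpha>\<in>Poly_Mapping.keys F. to_ac (Poly_Mapping.lookup F \<alpha>) *
        (\<Prod>i\<in>Poly_Mapping.keys \<alpha>. x i ^ Poly_Mapping.lookup \<alpha> i))"

definition rational_zeros ::
    "nat \<Rightarrow> (nat \<Rightarrow> nat) \<Rightarrow> 'k::{field, finite} mpolynomial \<Rightarrow> (nat \<Rightarrow> 'k alg_closure) set set" where
  "rational_zeros m a F = {P \<in> rational_points m a. \<forall>x\<in>P. eval_mpolynomial F x = 0}"

text \<open>
  The maximum is taken over a finite set, as there are only finitely many rational points;
  its value is meaningful whenever a nonzero weighted homogeneous polynomial of degree \<open>d\<close> exists.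
\<close>

definition e_max :: "'k::{field, finite} itself \<Rightarrow> nat \<Rightarrow> nat \<Rightarrow> (nat \<Rightarrow> nat) \<Rightarrow> nat" where
  "e_max _ d m a = Max {card (rational_zeros m a F) | F :: 'k mpolynomial.
     F \<noteq> 0 \<and> in_variables m F \<and> weighted_homogeneous a d F}"

end

theory Submission
  imports Defs
begin

text \<open>
  Let \<open>r < s\<close> attain the minimum \<open>a\<close>, put \<open>u = a / a\<^sub>r\<close>, \<open>v = a / a\<^sub>s\<close> and \<open>k = d / a\<close>.  Then \<open>X\<^sub>r\<^sup>u\<close> and
  \<open>X\<^sub>s\<^sup>v\<close> both have weighted degree \<open>a\<close>, so a binary form of degree \<open>k\<close> evaluated at
  \<open>(X\<^sub>r\<^sup>u, X\<^sub>s\<^sup>v)\<close> is weighted homogeneous of degree \<open>d\<close>.  The form used here is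
  \<open>S\<^sup>e \<Prod>\<^sub>c (R - c S)\<close>, where \<open>c\<close> runs over \<open>min k q\<close> elements of the field and \<open>e\<close> fills up the degree.
  If \<open>k > q\<close>, it vanishes at every rational pair.  If \<open>k \<le> q\<close>, its zeros contain the origin and, for
  each \<open>c\<close>, the curve \<open>x\<^sup>u = c y\<^sup>v\<close>, \<open>y \<noteq> 0\<close>.  Since \<open>u\<close> and \<open>v\<close> are coprime, the nonzero field elements
  inject into this curve (lemma \<open>card_binomial_curve_ge\<close>), so there are at least
  \<open>k (q - 1) + 1\<close> zero pairs.  The other \<open>m - 1\<close> coordinates are free, which gives
  at least \<open>(k (q - 1) + 1) q\<^bsup>m-1\<^esup> - 1 = (q - 1) (k q\<^bsup>m-1\<^esup> + p\<^bsub>m-2\<^esub>)\<close> nonzero rational vectors at which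
  the polynomial vanishes.

  It remains to pass from vectors to classes.  A class has at most \<open>q - 1\<close> representatives with
  coordinates in the base field (\<open>card_representatives_le\<close>): if \<open>l\<close> rescales one of them to another
  and \<open>g\<close> is the gcd of the weights on the support, then \<open>l\<^sup>g\<close> lies in the base field and determines
  the result.  Hence \<open>q - 1\<close> can be cancelled.  For the number of zeros to bound \<open>e\<^sub>q\<close> from
  below, the set whose maximum defines \<open>e\<^sub>q\<close> has to be finite.  This holds because every rational
  class contains a vector fixed by the Frobenius map (\<open>finite_rational_points\<close>).
\<close>

section \<open>Finite fields and their algebraic closure\<close>

text \<open>Multiplication by \<open>x \<noteq> 0\<close> permutes the nonzero elements, so it preserves their product.\<close>

lemma finite_field_power_card:
  fixes x :: "'k::{field, finite}"
  shows "x ^ CARD('k) = x"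
proof (cases "x = 0")
  case False
  let ?U = "UNIV - {0 :: 'k}"
  have "bij_betw ((*) x) ?U ?U"
    using False by (intro bij_betwI[where g = "\<lambda>y. y / x"]) auto
  hence "(\<Prod>y\<in>?U. x * y) = \<Prod>?U"
    by (rule prod.reindex_bij_betw)
  hence "x ^ card ?U * \<Prod>?U = \<Prod>?U"
    by (simp add: prod.distrib)
  hence "x ^ (CARD('k) - 1) = 1"
    by simp
  thus ?thesis
    using power_eq_if[of x "CARD('k)"] by simp
qed (simp add: zero_power)

lemma card_field_ge_2: "CARD('k::{field, finite}) \<ge> 2"
proof -
  have "card {0, 1 :: 'k} \<le> CARD('k)"
    by (intro card_mono) auto
  thus ?thesis by simp
qed

lemma finite_vectors: "finite {z :: nat \<Rightarrow> 'k::{zero, finite}. \<forall>i>m. z i = 0}"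
proof -
  have "finite {z :: nat \<Rightarrow> 'k. \<forall>i. (i \<in> {..m} \<longrightarrow> z i \<in> UNIV) \<and> (i \<notin> {..m} \<longrightarrow> z i = 0)}"
    by (intro finite_set_of_finite_funs) auto
  thus ?thesis by (rule rev_finite_subset) auto
qed

text \<open>
  For \<open>l \<noteq> 0\<close> the integers \<open>n\<close> for which \<open>l\<^sup>n\<close> lies in the base field form a subgroup, which by
  Bezout contains the gcd of any of its elements.
\<close>

lemma power_Gcd_in_range_to_ac:
  fixes l :: "'k::field alg_closure"
  assumes "finite N" "\<And>n. n \<in> N \<Longrightarrow> l ^ n \<in> range to_ac"
  shows "l ^ Gcd N \<in> range to_ac"
  using assms
proof (induction N rule: finite_induct)
  case empty
  have "to_ac 1 = l ^ 0" by simp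
  thus ?case by (metis Gcd_empty rangeI)
next
  case (insert n N)
  show ?case
  proof (cases "n = 0 \<or> l = 0")
    case True
    thus ?thesis
    proof
      assume "l = 0"
      thus ?thesis
        by (cases "Gcd (insert n N) = 0") (metis power_0 to_ac_1 rangeI, metis power_0_left to_ac_0 rangeI)
    qed (use insert in auto)
  next
    case False
    then obtain x y where xy: "n * x = Gcd N * y + gcd n (Gcd N)"
      using bezout_nat by blast
    obtain s where s: "l ^ n = to_ac s"
      using insert.prems by blast
    obtain t where t: "l ^ Gcd N = to_ac t"
      using insert by blast
    have "to_ac t ^ y * l ^ gcd n (Gcd N) = to_ac s ^ x"
      unfolding s[symmetric] t[symmetric] by (simp flip: power_mult power_add add: xy)
    moreover have "to_ac t \<noteq> 0"
      using False unfolding t[symmetric] by simp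
    ultimately have "l ^ gcd n (Gcd N) = to_ac (s ^ x / t ^ y)"
      by (simp add: field_simps)
    thus ?thesis by (metis Gcd_insert rangeI)
  qed
qed

section \<open>Classes and rational points\<close>

lemma equiv_wproj_rel:
  "equiv (nonzero_vectors m) (wproj_rel m a :: (nat \<Rightarrow> 'k::field alg_closure) rel)" (is "equiv ?A ?R")
proof (rule equivI)
  show "?R \<subseteq> ?A \<times> ?A"
    by (auto simp: wproj_rel_def)
  show "refl_on ?A ?R"
    by (auto simp: refl_on_def wproj_rel_def intro!: exI[of _ 1])
  show "sym ?R"
  proof (rule symI)
    fix x y :: "nat \<Rightarrow> 'k alg_closure"
    assume xy: "(x, y) \<in> ?R"
    then obtain l where "l \<noteq> 0" "\<And>i. i \<le> m \<Longrightarrow> y i = l ^ a i * x i"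
      by (auto simp: wproj_rel_def)
    with xy show "(y, x) \<in> ?R"
      by (auto simp: wproj_rel_def field_simps intro!: exI[of _ "inverse l"])
  qed
  show "trans ?R"
  proof (rule transI)
    fix x y z :: "nat \<Rightarrow> 'k alg_closure"
    assume xy: "(x, y) \<in> ?R" and yz: "(y, z) \<in> ?R"
    obtain l where l: "l \<noteq> 0" "\<And>i. i \<le> m \<Longrightarrow> y i = l ^ a i * x i"
      using xy by (auto simp: wproj_rel_def)
    obtain l' where l': "l' \<noteq> 0" "\<And>i. i \<le> m \<Longrightarrow> z i = l' ^ a i * y i"
      using yz by (auto simp: wproj_rel_def)
    show "(x, z) \<in> ?R"
      using xy yz l l'
      by (auto simp: wproj_rel_def power_mult_distrib intro!: exI[of _ "l' * l"])
  qed
qed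

lemma wproj_relI:
  assumes "x \<in> nonzero_vectors m" "l \<noteq> 0" "\<And>i. i \<le> m \<Longrightarrow> y i = l ^ a i * x i"
    and "\<And>i. i > m \<Longrightarrow> y i = 0"
  shows "(x, y) \<in> wproj_rel m a"
  using assms by (fastforce simp: wproj_rel_def nonzero_vectors_def)

lemma power_card_in_nonzero_vectors:
  fixes x :: "nat \<Rightarrow> 'k::{field, finite} alg_closure"
  assumes "x \<in> nonzero_vectors m"
  shows "(\<lambda>i. x i ^ CARD('k)) \<in> nonzero_vectors m"
  using assms by (auto simp: nonzero_vectors_def)

lemma wproj_point_in_rational_points:
  fixes z :: "nat \<Rightarrow> 'k::{field, finite}"
  assumes z: "to_ac \<circ> z \<in> nonzero_vectors m"
  shows "wproj_point m a (to_ac \<circ> z) \<in> rational_points m a"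
  unfolding rational_points_def
proof (intro CollectI conjI ballI)
  show "wproj_point m a (to_ac \<circ> z) \<in> wproj_space m a"
    using z by (auto simp: wproj_point_def wproj_space_def quotient_def)
next
  fix y
  assume "y \<in> wproj_point m a (to_ac \<circ> z)"
  hence y: "(to_ac \<circ> z, y) \<in> wproj_rel m a"
    by (simp add: wproj_point_def)
  then obtain l where l: "l \<noteq> 0" "\<And>i. i \<le> m \<Longrightarrow> y i = l ^ a i * to_ac (z i)"
    by (auto simp: wproj_rel_def)
  have "(to_ac \<circ> z, \<lambda>i. y i ^ CARD('k)) \<in> wproj_rel m a"
  proof (rule wproj_relI[OF z])
    show "l ^ CARD('k) \<noteq> 0" using l by simp
    show "y i ^ CARD('k) = (l ^ CARD('k)) ^ a i * (to_ac \<circ> z) i" if "i \<le> m" for i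
      using l(2)[OF that] finite_field_power_card[of "z i"]
      by (simp add: power_mult_distrib mult.commute flip: power_mult to_ac_power)
    show "y i ^ CARD('k) = 0" if "i > m" for i
      using y that by (auto simp: wproj_rel_def nonzero_vectors_def)
  qed
  with y show "wproj_point m a y = wproj_point m a (\<lambda>i. y i ^ CARD('k))"
    unfolding wproj_point_def
    by (metis equiv_class_eq equiv_wproj_rel)
qed

text \<open>
  This is Hilbert 90 for the multiplicative group: if the Frobenius map sends \<open>x\<close> to the rescaling
  of \<open>x\<close> by \<open>l\<close>, then rescaling \<open>x\<close> by a root \<open>t\<close> of \<open>t\<^bsup>q-1\<^esup> = 1 / l\<close> makes it fixed.  So every rational
  class meets the set of Frobenius-fixed vectors, whose coordinates are roots of \<open>T\<^sup>q - T\<close>.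
\<close>

lemma finite_rational_points:
  "finite (rational_points m a :: (nat \<Rightarrow> 'k::{field, finite} alg_closure) set set)"
proof -
  define B where "B = {t :: 'k alg_closure. t ^ CARD('k) = t}"
  define S where "S = {x :: nat \<Rightarrow> 'k alg_closure. \<forall>i. (i \<in> {..m} \<longrightarrow> x i \<in> B) \<and> (i \<notin> {..m} \<longrightarrow> x i = 0)}"
  have q2: "CARD('k) \<ge> 2" by (rule card_field_ge_2)
  have "finite B"
  proof -
    let ?p = "Polynomial.monom 1 CARD('k) - Polynomial.monom 1 1 :: 'k alg_closure poly"
    have "Polynomial.coeff ?p 1 \<noteq> Polynomial.coeff 0 1"
      using q2 by simp
    hence "?p \<noteq> 0" by metis
    hence "finite {t. poly ?p t = 0}" by (rule poly_roots_finite)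
    thus ?thesis by (simp add: B_def poly_monom)
  qed
  hence "finite S"
    unfolding S_def by (intro finite_set_of_finite_funs) auto
  moreover have "rational_points m a \<subseteq> wproj_point m a ` S"
  proof
    fix P :: "(nat \<Rightarrow> 'k alg_closure) set"
    assume P: "P \<in> rational_points m a"
    then obtain x where x: "x \<in> nonzero_vectors m" "P = wproj_point m a x"
      by (auto simp: rational_points_def wproj_space_def wproj_point_def quotient_def)
    have "x \<in> P"
      using x equiv_class_self[OF equiv_wproj_rel] by (auto simp: wproj_point_def)
    moreover have "\<forall>x\<in>P. wproj_point m a x = wproj_point m a (\<lambda>i. x i ^ CARD('k))"
      using P unfolding rational_points_def by blast
    ultimately have "wproj_rel m a `` {x} = wproj_rel m a `` {\<lambda>i. x i ^ CARD('k)}"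
      unfolding wproj_point_def by blast
    hence "(x, \<lambda>i. x i ^ CARD('k)) \<in> wproj_rel m a"
      by (rule eq_equiv_class[OF _ equiv_wproj_rel power_card_in_nonzero_vectors[OF x(1)]])
    then obtain l where l: "l \<noteq> 0" "\<And>i. i \<le> m \<Longrightarrow> x i ^ CARD('k) = l ^ a i * x i"
      by (auto simp: wproj_rel_def)
    obtain t where t: "t ^ (CARD('k) - 1) = inverse l"
      using nth_root_exists[of "CARD('k) - 1" "inverse l"] q2 by auto
    have t0: "t \<noteq> 0"
      using t l q2 by (auto simp: zero_power)
    have tl: "t ^ CARD('k) * l = t"
      using t l q2 power_eq_if[of t "CARD('k)"] by simp
    define y where "y = (\<lambda>i. t ^ a i * x i)"
    have xy: "(x, y) \<in> wproj_rel m a"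
      using x(1) t0 by (intro wproj_relI[where l = t]) (auto simp: y_def nonzero_vectors_def)
    have "y i ^ CARD('k) = y i" if "i \<le> m" for i
    proof -
      have "y i ^ CARD('k) = (t ^ CARD('k) * l) ^ a i * x i"
        using l(2)[OF that]
        by (simp add: y_def power_mult_distrib mult.commute mult.left_commute flip: power_mult)
      thus ?thesis by (simp add: tl y_def)
    qed
    moreover have "y i = 0" if "i > m" for i
      using that x(1) by (auto simp: y_def nonzero_vectors_def)
    ultimately have "y \<in> S" by (auto simp: S_def B_def)
    moreover have "P = wproj_point m a y"
      using equiv_class_eq[OF equiv_wproj_rel xy] x(2) by (simp add: wproj_point_def)
    ultimately show "P \<in> wproj_point m a ` S" by blast
  qed
  ultimately show ?thesis
    by (meson finite_imageI finite_subset)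
qed

text \<open>
  The representatives of the class of \<open>x\<close> over the base field are among the vectors
  \<open>\<lambda>i. t ^ (a i div g) * x i\<close> with \<open>t \<noteq> 0\<close> in the base field, where \<open>g\<close> is the gcd of the
  weights on the support of \<open>x\<close>.  The scalar \<open>l\<close> itself need not lie in the base field,
  but \<open>t = l\<^sup>g\<close> does.
\<close>

lemma card_representatives_le:
  fixes P :: "(nat \<Rightarrow> 'k::{field, finite} alg_closure) set"
  shows "card {z :: nat \<Rightarrow> 'k. to_ac \<circ> z \<in> nonzero_vectors m \<and> wproj_point m a (to_ac \<circ> z) = P}
           \<le> CARD('k) - 1" (is "card ?S \<le> _")
proof (cases "?S = {}")
  case False
  then obtain x where x: "to_ac \<circ> x \<in> nonzero_vectors m" "wproj_point m a (to_ac \<circ> x) = P"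
    by blast
  define I where "I = {i. i \<le> m \<and> x i \<noteq> 0}"
  define g where "g = Gcd (a ` I)"
  define \<phi> where "\<phi> = (\<lambda>t i. t ^ (a i div g) * x i)"
  have "?S \<subseteq> \<phi> ` (UNIV - {0})"
  proof
    fix z
    assume "z \<in> ?S"
    hence z: "to_ac \<circ> z \<in> nonzero_vectors m" "wproj_point m a (to_ac \<circ> z) = P"
      by auto
    hence "(to_ac \<circ> x, to_ac \<circ> z) \<in> wproj_rel m a"
      using x eq_equiv_class[OF _ equiv_wproj_rel] by (metis wproj_point_def)
    then obtain l where l: "l \<noteq> 0" "\<And>i. i \<le> m \<Longrightarrow> to_ac (z i) = l ^ a i * to_ac (x i)"
      by (auto simp: wproj_rel_def)
    have "l ^ g \<in> range to_ac"
      unfolding g_def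
    proof (rule power_Gcd_in_range_to_ac)
      show "finite (a ` I)" by (simp add: I_def)
      fix n
      assume "n \<in> a ` I"
      then obtain i where i: "i \<le> m" "x i \<noteq> 0" "n = a i"
        by (auto simp: I_def)
      hence "l ^ n = to_ac (z i / x i)"
        using l(2) by simp
      thus "l ^ n \<in> range to_ac" by blast
    qed
    then obtain t where t: "l ^ g = to_ac t" by blast
    have "z i = \<phi> t i" for i
    proof (cases "i \<in> I")
      case True
      hence "a i = g * (a i div g)"
        by (simp add: g_def)
      hence "l ^ a i = to_ac (t ^ (a i div g))"
        by (metis power_mult t to_ac_power)
      hence "to_ac (z i) = to_ac (\<phi> t i)"
        using l(2)[of i] True by (simp add: \<phi>_def I_def)
      thus ?thesis by simp
    next
      case False
      hence "i > m \<or> (i \<le> m \<and> x i = 0)"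
        by (auto simp: I_def)
      thus ?thesis
        using x(1) z(1) l(2)[of i] by (auto simp: \<phi>_def nonzero_vectors_def)
    qed
    moreover have "t \<noteq> 0"
      using t l(1) by auto
    ultimately show "z \<in> \<phi> ` (UNIV - {0})" by blast
  qed
  hence "card ?S \<le> card (UNIV - {0 :: 'k})"
    by (intro surj_card_le) auto
  thus ?thesis by simp
next
  case True
  thus ?thesis by (metis card.empty zero_le)
qed

section \<open>Weighted homogeneous polynomials in two variables\<close>

lemma eval_mpolynomial_superset:
  assumes "finite A" "Poly_Mapping.keys F \<subseteq> A"
  shows "eval_mpolynomial F x =
    (\<Sum>\<alpha>\<in>A. to_ac (Poly_Mapping.lookup F \<alpha>) *
       (\<Prod>i\<in>Poly_Mapping.keys \<alpha>. x i ^ Poly_Mapping.lookup \<alpha> i))"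
  unfolding eval_mpolynomial_def
  using assms by (intro sum.mono_neutral_left) (auto simp: in_keys_iff)

lemma eval_weighted_homogeneous_scale:
  assumes F: "in_variables m F" "weighted_homogeneous a d F"
    and y: "\<And>i. i \<le> m \<Longrightarrow> y i = l ^ a i * x i"
  shows "eval_mpolynomial F y = l ^ d * eval_mpolynomial F x"
  unfolding eval_mpolynomial_def sum_distrib_left
proof (rule sum.cong[OF refl])
  fix \<alpha>
  assume \<alpha>: "\<alpha> \<in> Poly_Mapping.keys F"
  have "(\<Prod>i\<in>Poly_Mapping.keys \<alpha>. y i ^ Poly_Mapping.lookup \<alpha> i)
      = (\<Prod>i\<in>Poly_Mapping.keys \<alpha>. l ^ (a i * Poly_Mapping.lookup \<alpha> i) * x i ^ Poly_Mapping.lookup \<alpha> i)"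
  proof (rule prod.cong[OF refl])
    fix i
    assume "i \<in> Poly_Mapping.keys \<alpha>"
    hence "i \<le> m" using F(1) \<alpha> by (auto simp: in_variables_def)
    thus "y i ^ Poly_Mapping.lookup \<alpha> i
        = l ^ (a i * Poly_Mapping.lookup \<alpha> i) * x i ^ Poly_Mapping.lookup \<alpha> i"
      by (simp add: y power_mult power_mult_distrib)
  qed
  also have "\<dots> = l ^ d * (\<Prod>i\<in>Poly_Mapping.keys \<alpha>. x i ^ Poly_Mapping.lookup \<alpha> i)"
    using F(2) \<alpha>
    by (simp add: prod.distrib weighted_homogeneous_def weighted_degree_def flip: power_sum)
  finally show "to_ac (Poly_Mapping.lookup F \<alpha>) * (\<Prod>i\<in>Poly_Mapping.keys \<alpha>. y i ^ Poly_Mapping.lookup \<alpha> i)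
      = l ^ d * (to_ac (Poly_Mapping.lookup F \<alpha>) * (\<Prod>i\<in>Poly_Mapping.keys \<alpha>. x i ^ Poly_Mapping.lookup \<alpha> i))"
    by simp
qed

definition two_var_exponent :: "nat \<Rightarrow> nat \<Rightarrow> nat \<Rightarrow> nat \<Rightarrow> (nat \<Rightarrow>\<^sub>0 nat)" where
  "two_var_exponent r s i j = Poly_Mapping.single r i + Poly_Mapping.single s j"

lemma lookup_two_var_exponent:
  "Poly_Mapping.lookup (two_var_exponent r s i j) n = (if n = r then i else 0) + (if n = s then j else 0)"
  by (auto simp: two_var_exponent_def lookup_add lookup_single)

lemma keys_two_var_exponent: "Poly_Mapping.keys (two_var_exponent r s i j) \<subseteq> {r, s}"
  by (auto simp: in_keys_iff lookup_two_var_exponent split: if_splits)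

lemma weighted_degree_two_var_exponent:
  assumes "r \<noteq> s"
  shows "weighted_degree a (two_var_exponent r s i j) = a r * i + a s * j"
proof -
  have "weighted_degree a (two_var_exponent r s i j) =
      (\<Sum>n\<in>{r, s}. a n * Poly_Mapping.lookup (two_var_exponent r s i j) n)"
    unfolding weighted_degree_def using keys_two_var_exponent
    by (intro sum.mono_neutral_left) (auto simp: in_keys_iff)
  thus ?thesis using assms by (simp add: lookup_two_var_exponent)
qed

lemma prod_two_var_exponent:
  fixes x :: "nat \<Rightarrow> 'b::comm_semiring_1"
  assumes "r \<noteq> s"
  shows "(\<Prod>n\<in>Poly_Mapping.keys (two_var_exponent r s i j).
            x n ^ Poly_Mapping.lookup (two_var_exponent r s i j) n) = x r ^ i * x s ^ j"
proof -
  have "(\<Prod>n\<in>Poly_Mapping.keys (two_var_exponent r s i j).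
            x n ^ Poly_Mapping.lookup (two_var_exponent r s i j) n) =
      (\<Prod>n\<in>{r, s}. x n ^ Poly_Mapping.lookup (two_var_exponent r s i j) n)"
    using keys_two_var_exponent
    by (intro prod.mono_neutral_left) (auto simp: in_keys_iff)
  thus ?thesis using assms by (simp add: lookup_two_var_exponent)
qed

text \<open>
  For \<open>f\<close> of degree at most \<open>k\<close>, this is the value at \<open>(x, y)\<close> of the binary form of degree \<open>k\<close>
  that dehomogenizes to \<open>f\<close>.  If \<open>k\<close> exceeds the degree of \<open>f\<close>, this form is the homogenization of \<open>f\<close> times a power of the second variable.
\<close>

definition homogenized_value :: "nat \<Rightarrow> 'k::field poly \<Rightarrow> 'k \<Rightarrow> 'k \<Rightarrow> 'k" where
  "homogenized_value k f x y = (\<Sum>j\<le>k. Polynomial.coeff f j * x ^ j * y ^ (k - j))"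

text \<open>
  The same binary form evaluated at \<open>(X\<^sub>r\<^sup>u, X\<^sub>s\<^sup>v)\<close>.  Prescribing the coefficients rather than
  multiplying linear factors lets the degree and the variables be read off the exponents.
\<close>

definition two_var_form ::
    "nat \<Rightarrow> nat \<Rightarrow> nat \<Rightarrow> nat \<Rightarrow> nat \<Rightarrow> 'k::field poly \<Rightarrow> 'k mpolynomial" where
  "two_var_form r s u v k f =
     (\<Sum>j\<le>k. Poly_Mapping.single (two_var_exponent r s (u * j) (v * (k - j))) (Polynomial.coeff f j))"

lemma inj_two_var_exponent:
  assumes "r \<noteq> s" "u > 0"
  shows "inj (\<lambda>j. two_var_exponent r s (u * j) (v * (k - j)))"
proof (rule injI)
  fix i j
  assume "two_var_exponent r s (u * i) (v * (k - i)) = two_var_exponent r s (u * j) (v * (k - j))"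
  hence "Poly_Mapping.lookup (two_var_exponent r s (u * i) (v * (k - i))) r
       = Poly_Mapping.lookup (two_var_exponent r s (u * j) (v * (k - j))) r"
    by simp
  thus "i = j" using assms by (simp add: lookup_two_var_exponent)
qed

lemma keys_two_var_form:
  "Poly_Mapping.keys (two_var_form r s u v k f)
     \<subseteq> (\<lambda>j. two_var_exponent r s (u * j) (v * (k - j))) ` {..k}"
  unfolding two_var_form_def
  by (rule order_trans[OF keys_sum]) auto

lemma lookup_two_var_form:
  assumes "r \<noteq> s" "u > 0" "j \<le> k"
  shows "Poly_Mapping.lookup (two_var_form r s u v k f) (two_var_exponent r s (u * j) (v * (k - j)))
           = Polynomial.coeff f j"
  using assms injD[OF inj_two_var_exponent[OF assms(1,2), of v k]]
  by (simp add: two_var_form_def lookup_sum lookup_single when_def)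
    (subst sum.cong[OF refl, of _ _ "\<lambda>i. if i = j then Polynomial.coeff f i else 0"]; auto)

lemma eval_two_var_form:
  fixes z :: "nat \<Rightarrow> 'k::field"
  assumes "r \<noteq> s" "u > 0"
  shows "eval_mpolynomial (two_var_form r s u v k f) (to_ac \<circ> z)
           = to_ac (homogenized_value k f (z r ^ u) (z s ^ v))"
proof -
  have "eval_mpolynomial (two_var_form r s u v k f) (to_ac \<circ> z) =
      (\<Sum>j\<le>k. to_ac (Polynomial.coeff f j) * (to_ac (z r) ^ (u * j) * to_ac (z s) ^ (v * (k - j))))"
    using inj_two_var_exponent[OF assms, of v k] assms
    by (subst eval_mpolynomial_superset[OF _ keys_two_var_form])
       (auto simp: sum.reindex inj_on_def inj_def prod_two_var_exponent lookup_two_var_form)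
  thus ?thesis
    by (simp add: homogenized_value_def to_ac_sum power_mult mult.assoc)
qed

lemma in_variables_two_var_form:
  assumes "r \<le> m" "s \<le> m"
  shows "in_variables m (two_var_form r s u v k f)"
  unfolding in_variables_def
  using keys_two_var_form[of r s u v k f] keys_two_var_exponent[of r s] assms by fastforce

lemma weighted_homogeneous_two_var_form:
  assumes "r \<noteq> s" "a r * u = w" "a s * v = w"
  shows "weighted_homogeneous a (w * k) (two_var_form r s u v k f)"
  unfolding weighted_homogeneous_def
proof
  fix \<alpha>
  assume "\<alpha> \<in> Poly_Mapping.keys (two_var_form r s u v k f)"
  then obtain j where j: "j \<le> k" "\<alpha> = two_var_exponent r s (u * j) (v * (k - j))"
    using keys_two_var_form[of r s u v k f] by auto
  hence "weighted_degree a \<alpha> = w * j + w * (k - j)"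
    using assms by (simp add: weighted_degree_two_var_exponent flip: mult.assoc)
  thus "weighted_degree a \<alpha> = w * k"
    using j by (simp flip: distrib_left)
qed

lemma two_var_form_nonzero:
  assumes "r \<noteq> s" "u > 0" "f \<noteq> 0" "Polynomial.degree f \<le> k"
  shows "two_var_form r s u v k f \<noteq> 0"
proof
  assume "two_var_form r s u v k f = 0"
  hence "Polynomial.coeff f (Polynomial.degree f) = 0"
    using lookup_two_var_form[OF assms(1,2,4), of v f] by simp
  thus False using assms by simp
qed

lemma homogenized_value_nonzero:
  assumes "Polynomial.degree f \<le> k" "y \<noteq> 0"
  shows "homogenized_value k f x y = y ^ k * poly f (x / y)"
proof -
  have "poly f (x / y) = (\<Sum>j\<le>k. Polynomial.coeff f j * (x / y) ^ j)"
    unfolding poly_altdef using assms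
    by (intro sum.mono_neutral_left) (auto simp: coeff_eq_0)
  thus ?thesis using assms
    by (auto simp: homogenized_value_def sum_distrib_left power_divide power_diff intro!: sum.cong)
qed

lemma homogenized_value_at_infinity: "homogenized_value k f x 0 = Polynomial.coeff f k * x ^ k"
proof -
  have "homogenized_value k f x 0 = (\<Sum>j\<le>k. if j = k then Polynomial.coeff f k * x ^ k else 0)"
    unfolding homogenized_value_def by (intro sum.cong) auto
  thus ?thesis by simp
qed

section \<open>Counting zeros over the base field\<close>

text \<open>
  For \<open>c \<noteq> 0\<close> and \<open>u \<alpha> = v \<beta> + 1\<close> the point \<open>(c\<^sup>\<alpha>, c\<^sup>\<beta>)\<close> lies on the curve, and \<open>(t\<^sup>v, t\<^sup>u)\<close> moves it along
  the curve.  Coprimality is used twice: for this point, and for recovering \<open>t\<close> from \<open>t\<^sup>u\<close> and \<open>t\<^sup>v\<close>.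
  For \<open>c = 0\<close> the curve is the punctured axis \<open>x = 0\<close>.
\<close>

lemma card_binomial_curve_ge:
  fixes c :: "'k::{field, finite}"
  assumes "coprime u v" "u > 0"
  shows "CARD('k) - 1 \<le> card {(x, y). y \<noteq> 0 \<and> x ^ u = c * y ^ v}"
proof -
  obtain \<alpha> \<beta> where b: "u * \<alpha> = v * \<beta> + 1"
    using bezout_nat[of u v] assms by auto
  define \<phi> where "\<phi> = (\<lambda>t. if c = 0 then (0, t) else (c ^ \<alpha> * t ^ v, c ^ \<beta> * t ^ u))"
  have "inj_on \<phi> (UNIV - {0})"
  proof (rule inj_onI)
    fix t t'
    assume t: "t \<in> UNIV - {0}" "t' \<in> UNIV - {0}" "\<phi> t = \<phi> t'"
    show "t = t'"
    proof (cases "c = 0")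
      case False
      hence *: "t ^ v = t' ^ v" "t ^ u = t' ^ u"
        using t by (auto simp: \<phi>_def)
      have "t ^ (v * \<beta>) * t = (t ^ u) ^ \<alpha>" "t' ^ (v * \<beta>) * t' = (t' ^ u) ^ \<alpha>"
        by (simp_all add: b flip: power_mult)
      with * have "(t' ^ v) ^ \<beta> * t = (t' ^ v) ^ \<beta> * t'"
        by (simp add: power_mult)
      with t show ?thesis by simp
    qed (use t in \<open>auto simp: \<phi>_def\<close>)
  qed
  moreover have "\<phi> ` (UNIV - {0}) \<subseteq> {(x, y). y \<noteq> 0 \<and> x ^ u = c * y ^ v}"
  proof (cases "c = 0")
    case False
    have "c ^ (u * \<alpha>) = c * c ^ (v * \<beta>)"
      by (simp add: b)
    thus ?thesis using False
      by (auto simp: \<phi>_def power_mult_distrib ac_simps simp flip: power_mult)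
  qed (use assms in \<open>auto simp: \<phi>_def\<close>)
  ultimately have "card (UNIV - {0 :: 'k}) \<le> card {(x, y). y \<noteq> 0 \<and> x ^ u = c * y ^ v}"
    by (intro card_inj_on_le) auto
  thus ?thesis by simp
qed

text \<open>
  The polynomial is a product of distinct linear factors, \<open>k\<close> of them if possible.  Each root
  contributes one curve, disjoint from the others because \<open>c = x\<^sup>u / y\<^sup>v\<close> can be recovered, and \<open>+ 1\<close>
  counts the origin.  When \<open>k > q\<close> all field elements are roots, and the surplus degree makes the
  form vanish at infinity too, that is, on \<open>y = 0\<close>.
\<close>

lemma exists_poly_many_zero_pairs:
  assumes "coprime u v" "u > 0" "v > 0" "k > 0"
  obtains f :: "'k::{field, finite} poly" where "f \<noteq> 0" "Polynomial.degree f \<le> k"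
    and "min (CARD('k) ^ 2) (k * (CARD('k) - 1) + 1)
           \<le> card {(x, y). homogenized_value k f (x ^ u) (y ^ v) = 0}"
proof -
  define q where "q = CARD('k)"
  have q: "q \<ge> 2" unfolding q_def by (rule card_field_ge_2)
  obtain C :: "'k set" where C: "card C = min k q"
    using obtain_subset_with_card_n[of "min k q" "UNIV :: 'k set"] by (auto simp: q_def)
  define f where "f = (\<Prod>c\<in>C. [:-c, 1:])"
  have f0: "f \<noteq> 0" and deg: "Polynomial.degree f = min k q"
    by (simp_all add: f_def degree_prod_eq_sum_degree C)
  have fC: "poly f c = 0" if "c \<in> C" for c
    using that by (auto simp: f_def poly_prod)
  let ?W = "{(x, y). homogenized_value k f (x ^ u) (y ^ v) = 0}"
  have "min (q ^ 2) (k * (q - 1) + 1) \<le> card ?W"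
  proof (cases "k \<le> q")
    case True
    let ?Z = "\<lambda>c. {(x, y :: 'k). y \<noteq> 0 \<and> x ^ u = c * y ^ v}"
    have "k * (q - 1) + 1 \<le> (\<Sum>c\<in>C. card (?Z c)) + 1"
      using sum_mono[OF card_binomial_curve_ge[OF assms(1,2)], of C "\<lambda>c. c"] C True
      by (simp add: q_def)
    also have "(\<Sum>c\<in>C. card (?Z c)) = card (\<Union>c\<in>C. ?Z c)"
      by (subst card_UN_disjoint) auto
    also have "card (\<Union>c\<in>C. ?Z c) + 1 = card (insert (0, 0) (\<Union>c\<in>C. ?Z c))"
      by (subst card_insert_disjoint) auto
    also have "\<dots> \<le> card ?W"
    proof (rule card_mono)
      show "insert (0, 0) (\<Union>c\<in>C. ?Z c) \<subseteq> ?W"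
        using assms deg fC True
        by (auto simp: homogenized_value_nonzero homogenized_value_at_infinity zero_power)
    qed auto
    finally show ?thesis by simp
  next
    case False
    hence "C = UNIV"
      using C by (intro card_eq_UNIV_imp_eq_UNIV) (auto simp: q_def)
    have "homogenized_value k f x y = 0" for x y
    proof (cases "y = 0")
      case True
      thus ?thesis using False deg
        by (simp add: homogenized_value_at_infinity coeff_eq_0)
    qed (use deg fC \<open>C = UNIV\<close> in \<open>simp add: homogenized_value_nonzero\<close>)
    hence "?W = UNIV" by auto
    thus ?thesis by (simp add: q_def power2_eq_square flip: UNIV_Times_UNIV add: card_cartesian_product)
  qed
  thus ?thesis using that[of f] f0 deg by (simp add: q_def)
qed

lemma card_vectors_with_pair_in:
  fixes W :: "('k::{field, finite} \<times> 'k) set"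
  assumes "r < s" "s \<le> m"
  shows "card W * CARD('k) ^ (m - 1) \<le> card {z. (\<forall>i>m. z i = 0) \<and> (z r, z s) \<in> W}"
proof -
  let ?E = "{..m} - {r, s}"
  define \<phi> where "\<phi> = (\<lambda>(p :: 'k \<times> 'k, w :: nat \<Rightarrow> 'k) i.
    if i = r then fst p else if i = s then snd p else if i \<le> m then w i else 0)"
  have "card ?E = m - 1"
    using assms by (subst card_Diff_subset) auto
  hence "card W * CARD('k) ^ (m - 1) = card (W \<times> (?E \<rightarrow>\<^sub>E (UNIV :: 'k set)))"
    by (simp add: card_cartesian_product card_funcsetE)
  also have "\<dots> \<le> card {z :: nat \<Rightarrow> 'k. (\<forall>i>m. z i = 0) \<and> (z r, z s) \<in> W}"
  proof (rule card_inj_on_le)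
    show "inj_on \<phi> (W \<times> (?E \<rightarrow>\<^sub>E UNIV))"
    proof (rule inj_onI, clarify)
      fix p1 p2 p1' p2' :: 'k and w w' :: "nat \<Rightarrow> 'k"
      assume w: "w \<in> ?E \<rightarrow>\<^sub>E UNIV" "w' \<in> ?E \<rightarrow>\<^sub>E UNIV"
        and eq: "\<phi> ((p1, p2), w) = \<phi> ((p1', p2'), w')"
      have "p1 = p1'" "p2 = p2'"
        using fun_cong[OF eq, of r] fun_cong[OF eq, of s] assms by (auto simp: \<phi>_def)
      moreover have "w = w'"
      proof (rule PiE_ext[OF w])
        fix i
        assume "i \<in> ?E"
        thus "w i = w' i"
          using fun_cong[OF eq, of i] by (auto simp: \<phi>_def)
      qed
      ultimately show "(p1, p2) = (p1', p2') \<and> w = w'" by simp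
    qed
    show "\<phi> ` (W \<times> (?E \<rightarrow>\<^sub>E UNIV)) \<subseteq> {z. (\<forall>i>m. z i = 0) \<and> (z r, z s) \<in> W}"
    proof (rule image_subsetI)
      fix pw
      assume "pw \<in> W \<times> (?E \<rightarrow>\<^sub>E (UNIV :: 'k set))"
      moreover have "(\<phi> pw r, \<phi> pw s) = fst pw" "\<forall>i>m. \<phi> pw i = 0"
        using assms by (auto simp: \<phi>_def split_beta)
      ultimately show "\<phi> pw \<in> {z. (\<forall>i>m. z i = 0) \<and> (z r, z s) \<in> W}"
        by auto
    qed
    show "finite {z :: nat \<Rightarrow> 'k. (\<forall>i>m. z i = 0) \<and> (z r, z s) \<in> W}"
      using finite_vectors[of m] by (rule rev_finite_subset) auto
  qed
  finally show ?thesis .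
qed

text \<open>
  Every zero of \<open>F\<close> over the base field represents a rational class in \<open>V(F)\<close>, and each class is
  reached at most \<open>q - 1\<close> times.
\<close>

lemma card_rational_zeros_ge:
  fixes F :: "'k::{field, finite} mpolynomial"
  assumes F: "in_variables m F" "weighted_homogeneous a d F"
  shows "card {z. to_ac \<circ> z \<in> nonzero_vectors m \<and> eval_mpolynomial F (to_ac \<circ> z) = 0}
           \<le> (CARD('k) - 1) * card (rational_zeros m a F)" (is "card ?Z \<le> _")
proof -
  define fiber where "fiber = (\<lambda>P :: (nat \<Rightarrow> 'k alg_closure) set.
    {z :: nat \<Rightarrow> 'k. to_ac \<circ> z \<in> nonzero_vectors m \<and> wproj_point m a (to_ac \<circ> z) = P})"
  have fin: "finite (rational_zeros m a F)"
    using finite_rational_points by (rule rev_finite_subset) (auto simp: rational_zeros_def)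
  have fin_fiber: "finite (fiber P)" for P
    using finite_vectors[of m]
    by (rule rev_finite_subset) (auto simp: fiber_def nonzero_vectors_def)
  have "?Z \<subseteq> (\<Union>P\<in>rational_zeros m a F. fiber P)"
  proof
    fix z
    assume z: "z \<in> ?Z"
    have "eval_mpolynomial F y = 0" if y: "y \<in> wproj_point m a (to_ac \<circ> z)" for y
    proof -
      obtain l where "\<And>i. i \<le> m \<Longrightarrow> y i = l ^ a i * (to_ac \<circ> z) i"
        using y by (auto simp: wproj_point_def wproj_rel_def)
      from eval_weighted_homogeneous_scale[OF F this] z show ?thesis
        by (metis (mono_tags, lifting) mem_Collect_eq mult_zero_right)
    qed
    with z show "z \<in> (\<Union>P\<in>rational_zeros m a F. fiber P)"
      by (auto simp: rational_zeros_def fiber_def wproj_point_in_rational_points)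
  qed
  hence "card ?Z \<le> card (\<Union>P\<in>rational_zeros m a F. fiber P)"
    using fin fin_fiber by (intro card_mono) auto
  also have "\<dots> \<le> (\<Sum>P\<in>rational_zeros m a F. card (fiber P))"
    by (rule card_UN_le[OF fin])
  also have "\<dots> \<le> (\<Sum>P\<in>rational_zeros m a F. CARD('k) - 1)"
    unfolding fiber_def by (intro sum_mono card_representatives_le)
  finally show ?thesis by (simp add: mult.commute)
qed

section \<open>The lower bound\<close>

lemma card_rational_zeros_le_e_max:
  fixes F :: "'k::{field, finite} mpolynomial"
  assumes "F \<noteq> 0" "in_variables m F" "weighted_homogeneous a d F"
  shows "card (rational_zeros m a F) \<le> e_max TYPE('k) d m a"
  unfolding e_max_def
proof (rule Max_ge)
  let ?V = "rational_points m a :: (nat \<Rightarrow> 'k alg_closure) set set"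
  have "card (rational_zeros m a G) \<le> card ?V" for G :: "'k mpolynomial"
    unfolding rational_zeros_def by (rule card_mono[OF finite_rational_points]) blast
  hence "{card (rational_zeros m a F) | F :: 'k mpolynomial.
      F \<noteq> 0 \<and> in_variables m F \<and> weighted_homogeneous a d F} \<subseteq> {..card ?V}"
    by blast
  thus "finite {card (rational_zeros m a F) | F :: 'k mpolynomial.
      F \<noteq> 0 \<and> in_variables m F \<and> weighted_homogeneous a d F}"
    by (rule finite_subset) simp
qed (use assms in blast)

lemma p_num_times:
  assumes "q \<ge> 1"
  shows "(q - 1) * p_num q r + 1 = q ^ nat (r + 1)"
proof -
  obtain p where q: "q = Suc p"
    using assms by (cases q) auto
  have "(q - 1) * (\<Sum>i\<le>n. q ^ i) + 1 = q ^ Suc n" for n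
    unfolding q by (induction n) (simp_all add: distrib_left)
  from this[of "nat r"] show ?thesis
    by (auto simp: p_num_def nat_add_distrib)
qed

text \<open>
  The claimed bound times \<open>q - 1\<close> does not exceed the number of nonzero vectors found: the two arguments of the
  minimum on the left correspond to those on the right, the \<open>+ 1\<close> standing for the zero vector.
\<close>

lemma times_min_p_num_le:
  assumes "q \<ge> 2" "m \<ge> 1"
  shows "(q - 1) * min (p_num q (int m)) (k * q ^ (m - 1) + p_num q (int m - 2)) + 1
           \<le> min (q ^ 2) (k * (q - 1) + 1) * q ^ (m - 1)" (is "(q - 1) * ?min + 1 \<le> _")
proof -
  obtain n where m: "m = Suc n"
    using assms(2) by (cases m) auto
  have all: "(q - 1) * p_num q (int m) + 1 = q ^ 2 * q ^ n"
    using p_num_times[of q "int m"] assms by (simp add: m nat_add_distrib power2_eq_square)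
  have "(q - 1) * p_num q (int m - 2) + 1 = q ^ n"
    using p_num_times[of q "int m - 2"] assms by (simp add: m)
  hence some: "(q - 1) * (k * q ^ n + p_num q (int m - 2)) + 1 = (k * (q - 1) + 1) * q ^ n"
    by (simp add: algebra_simps)
  show ?thesis
  proof (cases "q ^ 2 \<le> k * (q - 1) + 1")
    case True
    have "(q - 1) * ?min \<le> (q - 1) * p_num q (int m)"
      by (intro mult_left_mono) auto
    with all have "(q - 1) * ?min + 1 \<le> q ^ 2 * q ^ n"
      by linarith
    with True show ?thesis by (simp add: m min_absorb1)
  next
    case False
    have "(q - 1) * ?min \<le> (q - 1) * (k * q ^ n + p_num q (int m - 2))"
      by (intro mult_left_mono) (auto simp: m)
    with some have "(q - 1) * ?min + 1 \<le> (k * (q - 1) + 1) * q ^ n"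
      by linarith
    with False show ?thesis by (simp add: m min_absorb2)
  qed
qed

theorem lemma1:
  fixes q d m a_min :: nat and a :: "nat \<Rightarrow> nat"
  assumes "q = CARD('k::{field, finite})"
    and "m \<ge> 1"
    and "\<And>i. i \<le> m \<Longrightarrow> a i > 0"
    and "a_min = Min {lcm (a r) (a s) | r s. r < s \<and> s \<le> m}"
    and "a_min dvd d"
    and "d > 0 \<or> m = 1"
  shows "e_max TYPE('k) d m a
           \<ge> min (p_num q (int m)) (d div a_min * q ^ (m - 1) + p_num q (int m - 2))"
proof (cases "d = 0")
  case True
  \<comment> \<open>Here \<open>m = 1\<close>, so the bound is \<open>0 + p\<^bsub>-1\<^esub> = 0\<close>.\<close>
  with assms(6) show ?thesis by (simp add: p_num_def)
next
  case False
  have q: "q \<ge> 2" using assms(1) card_field_ge_2 by simp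
  let ?L = "{lcm (a r) (a s) | r s. r < s \<and> s \<le> m}"
  have "?L \<subseteq> (\<lambda>(r, s). lcm (a r) (a s)) ` ({..m} \<times> {..m})"
    by force
  hence "finite ?L" by (rule finite_subset) auto
  moreover have "lcm (a 0) (a 1) \<in> ?L"
    using assms(2) by force
  ultimately have "a_min \<in> ?L"
    unfolding assms(4) by (intro Min_in) auto
  then obtain r s where rs: "r < s" "s \<le> m" "a_min = lcm (a r) (a s)"
    by blast
  hence pos: "a r > 0" "a s > 0" using assms(3) by auto
  define u v k where "u = a_min div a r" and "v = a_min div a s" and "k = d div a_min"
  have au: "a r * u = a_min" "a s * v = a_min"
    by (simp_all add: u_def v_def rs(3))
  have a_min: "a_min > 0" using pos rs(3) by (simp add: lcm_pos_nat)
  have uv: "u > 0" "v > 0" using au a_min by (auto intro: Nat.gr0I)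
  have "coprime u v"
  proof -
    \<comment> \<open>Dividing the lcm by one weight leaves the other weight divided by the gcd.\<close>
    have "a r * u = a r * (a s div gcd (a r) (a s))" "a s * v = a s * (a r div gcd (a r) (a s))"
      unfolding au rs(3) by (simp_all add: lcm_nat_def div_mult_swap mult.commute)
    with pos have "u = a s div gcd (a r) (a s)" "v = a r div gcd (a r) (a s)"
      by simp_all
    thus ?thesis
      using div_gcd_coprime[of "a r" "a s"] pos by (simp add: coprime_commute)
  qed
  have d: "d = a_min * k" using assms(5) by (simp add: k_def)
  have k: "k > 0" using False d by (auto intro: Nat.gr0I)
  obtain f :: "'k poly" where f: "f \<noteq> 0" "Polynomial.degree f \<le> k"
    and card_W: "min (q ^ 2) (k * (q - 1) + 1)
           \<le> card {(x, y). homogenized_value k f (x ^ u) (y ^ v) = 0}"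
    using exists_poly_many_zero_pairs[OF \<open>coprime u v\<close> uv k] assms(1) by metis
  define W where "W = {(x, y). homogenized_value k f (x ^ u) (y ^ v) = 0}"
  define F where "F = two_var_form r s u v k f"
  have F: "F \<noteq> 0" "in_variables m F" "weighted_homogeneous a d F"
    unfolding F_def d using rs f uv au
    by (simp_all add: two_var_form_nonzero in_variables_two_var_form weighted_homogeneous_two_var_form)
  let ?V = "{z :: nat \<Rightarrow> 'k. (\<forall>i>m. z i = 0) \<and> (z r, z s) \<in> W}"
  let ?Z = "{z. to_ac \<circ> z \<in> nonzero_vectors m \<and> eval_mpolynomial F (to_ac \<circ> z) = 0}"
  have "?V - {\<lambda>_. 0} \<subseteq> ?Z"
  proof
    fix z
    assume z: "z \<in> ?V - {\<lambda>_. 0}"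
    hence "\<exists>i. z i \<noteq> 0" by auto
    then obtain i where i: "z i \<noteq> 0" by blast
    have "\<forall>j>m. z j = 0" "(z r, z s) \<in> W"
      using z by blast+
    moreover from this i have "i \<le> m"
      using not_le by blast
    moreover have "eval_mpolynomial F (to_ac \<circ> z) = to_ac (homogenized_value k f (z r ^ u) (z s ^ v))"
      unfolding F_def using rs uv by (intro eval_two_var_form) auto
    ultimately show "z \<in> ?Z"
      using i unfolding nonzero_vectors_def W_def by auto
  qed
  moreover have "finite ?Z"
    using finite_vectors[of m] by (rule rev_finite_subset) (auto simp: nonzero_vectors_def)
  ultimately have "card (?V - {\<lambda>_. 0}) \<le> card ?Z"
    by (rule card_mono[rotated])
  hence "card ?V - 1 \<le> card ?Z"
    using diff_card_le_card_Diff[of "{\<lambda>_. 0}" ?V] by simp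
  hence "card W * q ^ (m - 1) - 1 \<le> (q - 1) * card (rational_zeros m a F)"
    using card_vectors_with_pair_in[OF rs(1,2), of W] card_rational_zeros_ge[OF F(2,3)]
    unfolding assms(1) by linarith
  moreover have "min (q ^ 2) (k * (q - 1) + 1) * q ^ (m - 1) \<le> card W * q ^ (m - 1)"
    using card_W by (intro mult_right_mono) (auto simp: W_def)
  ultimately have "(q - 1) * min (p_num q (int m)) (k * q ^ (m - 1) + p_num q (int m - 2))
      \<le> (q - 1) * card (rational_zeros m a F)"
    using times_min_p_num_le[OF q assms(2), of k] by linarith
  hence "min (p_num q (int m)) (k * q ^ (m - 1) + p_num q (int m - 2)) \<le> card (rational_zeros m a F)"
    using q by simp
  also have "\<dots> \<le> e_max TYPE('k) d m a"
    by (rule card_rational_zeros_le_e_max[OF F])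
  finally show ?thesis by (simp add: k_def)
qed

end
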